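(* Let $A\in\mathbb{R}^{n\times d}$ have SVD $A=U\Sigma V^T$ with singular values $\sigma_1\ge\dots\ge\sigma_d>0$, let $1\le k<d$ and $\Delta>0$, and assume $\sigma_k^2-\sigma_{k+1}^2\ge\Delta\sigma_1^2$. Let $\kappa_k=\sigma_1^2/\sigma_k^2$. Let $\tilde A\in\mathbb{R}^{n\times\ell}$ satisfy $\|AA^T-\tilde A\tilde A^T\|\le\mu\sigma_1^2$, with SVD $\tilde A=\tilde U\tilde\Sigma\tilde V^T$. If $\mu\le\min(\Delta^3(k\kappa_k)^2,\,1/(20k\kappa_k))$, then $$\|U_k\Sigma_k^{-2}U_k^T-\tilde U_k\Sigma_k^{-2}\tilde U_k^T\|\le\frac{8}{\sigma_k^2}(\mu k\kappa_k)^{1/3}.$$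
   Context: $\|\cdot\|$ is the operator (spectral) norm. Singular values are ordered non-increasingly. $U_k$ and $\tilde U_k$ denote the $n\times k$ matrices whose columns are the first $k$ columns of $U$ and $\tilde U$ (top $k$ left singular vectors, in order), and $\Sigma_k=\mathrm{diag}(\sigma_1,\dots,\sigma_k)$ contains the top $k$ singular values of $A$ (the same $\Sigma_k$ appears in both terms). *)

theory Defs
  imports "HOL-Analysis.Analysis"
begin

text \<open>Matrices are indexed by finite linearly ordered types, so that ``the first \<open>k\<close> columns''
  makes sense; \<open>position i\<close> is the 1-based position of the index \<open>i\<close>.\<close>

definition position :: "'a::{finite,linorder} \<Rightarrow> nat" where
  "position i = card {j. j \<le> i}"

definition rect_diag ::
    "(nat \<Rightarrow> real) \<Rightarrow> real ^ 'c::{finite,linorder} ^ 'r::{finite,linorder}" where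
  "rect_diag s = (\<chi> i j. if position i = position j then s (position i) else 0)"

text \<open>Full SVD \<open>A = U \<Sigma> V\<^sup>T\<close> with square orthogonal \<open>U\<close>, \<open>V\<close>. The singular values are
  \<open>s 1 \<ge> s 2 \<ge> \<dots> \<ge> 0\<close>, continued by \<open>0\<close> beyond the smaller dimension of \<open>A\<close>, so that
  \<open>s m > 0\<close> implies that \<open>A\<close> really has at least \<open>m\<close> positive singular values;
  \<open>s 0\<close> is unused.\<close>

definition is_svd ::
    "real ^ 'c::{finite,linorder} ^ 'r::{finite,linorder}
      \<Rightarrow> real ^ 'r::{finite,linorder} ^ 'r::{finite,linorder} \<Rightarrow> (nat \<Rightarrow> real)
      \<Rightarrow> real ^ 'c::{finite,linorder} ^ 'c::{finite,linorder} \<Rightarrow> bool" where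
  "is_svd A U s V \<longleftrightarrow>
     orthogonal_matrix U \<and> orthogonal_matrix V \<and>
     A = U ** rect_diag s ** transpose V \<and>
     (\<forall>i\<ge>1. 0 \<le> s i) \<and> (\<forall>i\<ge>1. s (Suc i) \<le> s i) \<and>
     (\<forall>i. i > min CARD('r) CARD('c) \<longrightarrow> s i = 0)"

text \<open>The number \<open>k\<close> of selected columns is \<open>CARD('k)\<close>; meaningful for \<open>CARD('k) \<le> CARD('c)\<close>.\<close>

definition first_columns ::
    "real ^ 'c::{finite,linorder} ^ 'r::{finite,linorder}
      \<Rightarrow> real ^ 'k::{finite,linorder} ^ 'r::{finite,linorder}" where
  "first_columns M = (\<chi> i j. M $ i $ (THE c. position c = position j))"

end

theory Submission
  imports Defs
begin

text \<open>
  Let \<open>f\<close> and \<open>g\<close> be the eigenvalues of \<open>B = A A\<^sup>T\<close> and \<open>B' = A' A'\<^sup>T\<close>, where \<open>\<parallel>B - B'\<parallel> \<le> \<epsilon>\<close>,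
  let \<open>P\<close> and \<open>Q\<close> be the spectral projections on the top \<open>k\<close> eigenvectors, and let \<open>M\<close> and \<open>N\<close>
  be the inverses of \<open>B\<close> and \<open>B'\<close> truncated to these. From \<open>M B = P\<close> and \<open>B' N = Q\<close> one gets
  \<open>M - N = M (P (1 - Q)) - M (B - B') N - ((1 - P) Q) N\<close>.
  The mixed products of projections are \<open>O(\<epsilon> / (f k - f (k + 1)))\<close> by a Davis-Kahan argument,
  and Weyl's inequality allows the eigenvalues \<open>g\<close> in \<open>N\<close> to be replaced by \<open>f\<close>. With
  \<open>\<delta> = (\<mu> k \<kappa>)\<^bsup>1/3\<^esup>\<close> the hypotheses on \<open>\<mu>\<close> say \<open>\<epsilon> \<le> \<delta>\<^sup>3 f k\<close> and \<open>\<epsilon> \<le> \<delta>\<^sup>2 (f k - f (k + 1))\<close>, so the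
  error is even \<open>O(\<delta>\<^sup>2 / f k)\<close>.
\<close>

section \<open>Operator norms of real matrices\<close>

abbreviation opnorm :: "real ^ 'c ^ 'r \<Rightarrow> real" where
  "opnorm M \<equiv> onorm ((*v) M)"

lemma opnorm_nonneg: "0 \<le> opnorm M"
  by (rule onorm_pos_le) simp

lemma opnorm_bound: "norm (M *v x) \<le> opnorm M * norm x"
  by (rule onorm) simp

lemma opnorm_mult: "opnorm (M ** N) \<le> opnorm M * opnorm N"
proof -
  have "(*v) (M ** N) = (*v) M \<circ> (*v) N"
    by (auto simp: matrix_vector_mul_assoc)
  then show ?thesis
    using onorm_compose[of "(*v) M" "(*v) N"] by simp
qed

lemma opnorm_mult_le:
  assumes "opnorm M \<le> a" "opnorm N \<le> b"
  shows "opnorm (M ** N) \<le> a * b"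
  by (meson assms mult_mono opnorm_mult opnorm_nonneg order_trans)

lemma opnorm_add: "opnorm (M + N) \<le> opnorm M + opnorm N"
proof -
  have "(*v) (M + N) = (\<lambda>x. M *v x + N *v x)"
    by (auto simp: matrix_vector_mult_add_rdistrib)
  then show ?thesis
    using onorm_triangle[of "(*v) M" "(*v) N"] by simp
qed

lemma opnorm_uminus: "opnorm (- M) = opnorm M"
proof -
  have "(*v) (- M) = (\<lambda>x. - (M *v x))"
    by (auto simp: matrix_vector_mult_def vec_eq_iff sum_negf)
  then show ?thesis by (simp add: onorm_neg)
qed

lemma opnorm_diff: "opnorm (M - N) \<le> opnorm M + opnorm N"
  using opnorm_add[of M "- N"] by (simp add: opnorm_uminus)

lemma opnorm_minus_commute: "opnorm (M - N) = opnorm (N - M)"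
  using opnorm_uminus[of "M - N"] by simp

text \<open>Cauchy-Schwarz bounds the squared norm of \<open>?y\<close> by
  \<open>norm x * opnorm M * norm ?y\<close>; one factor \<open>norm ?y\<close> then cancels.
  Invariance under transposition later serves to swap the factors in a product of two
  projections.\<close>

lemma opnorm_transpose_le: "opnorm (transpose M) \<le> opnorm M"
proof (rule onorm_le)
  fix x
  let ?y = "transpose M *v x"
  have "norm ?y * norm ?y = ?y \<bullet> ?y"
    by (simp add: dot_square_norm power2_eq_square)
  also have "\<dots> = x \<bullet> (M *v ?y)"
    by (metis dot_lmul_matrix transpose_matrix_vector)
  also have "\<dots> \<le> norm x * norm (M *v ?y)"
    by (rule norm_cauchy_schwarz)
  also have "\<dots> \<le> norm x * (opnorm M * norm ?y)"
    by (intro mult_left_mono opnorm_bound) simp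
  finally show "norm ?y \<le> opnorm M * norm x"
    using opnorm_nonneg[of M]
    by (cases "norm ?y = 0") (simp_all add: mult.assoc mult.left_commute mult.commute)
qed

lemma opnorm_transpose: "opnorm (transpose M) = opnorm M"
  using opnorm_transpose_le[of M] opnorm_transpose_le[of "transpose M"] by simp

section \<open>Matrix differences, inverses and orthogonal matrices\<close>

lemma matrix_diff_ldistrib: "L ** (M - N) = L ** M - L ** N"
  for L M N :: "'a::ring_1 ^ _ ^ _"
  by (simp add: matrix_matrix_mult_def vec_eq_iff algebra_simps sum_subtractf)

lemma matrix_diff_rdistrib: "(M - N) ** L = M ** L - N ** L"
  for L M N :: "'a::ring_1 ^ _ ^ _"
  by (simp add: matrix_matrix_mult_def vec_eq_iff algebra_simps sum_subtractf)

lemma matrix_inv_unique: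
  fixes M N :: "real ^ 'n ^ 'n"
  assumes "M ** N = mat 1"
  shows "matrix_inv M = N"
proof -
  have "M ** matrix_inv M = mat 1 \<and> matrix_inv M ** M = mat 1"
    unfolding matrix_inv_def
    by (rule someI[of _ N]) (use assms matrix_left_right_inverse in blast)
  then show ?thesis
    by (metis assms matrix_mul_assoc matrix_mul_lid matrix_mul_rid)
qed

lemma norm_orthogonal:
  assumes "orthogonal_matrix (Q :: real ^ 'n ^ 'n)"
  shows "norm (Q *v x) = norm x"
proof -
  have "(Q *v x) \<bullet> (Q *v x) = x \<bullet> (transpose Q *v (Q *v x))"
    by (metis dot_lmul_matrix inner_commute transpose_matrix_vector)
  also have "transpose Q *v (Q *v x) = x"
    using assms unfolding matrix_vector_mul_assoc orthogonal_matrix_def by simp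
  finally show ?thesis by (simp add: norm_eq_sqrt_inner)
qed

lemma norm_transpose_orthogonal:
  assumes "orthogonal_matrix (Q :: real ^ 'n ^ 'n)"
  shows "norm (transpose Q *v x) = norm x"
  using assms by (intro norm_orthogonal) (auto simp: orthogonal_matrix_def)

section \<open>Positions as an enumeration of a finite linear order\<close>

lemma position_less: "position i < position j" if "i < j"
  unfolding position_def
proof (rule psubset_card_mono)
  have "j \<notin> {j. j \<le> i}" using that by simp
  then show "{j. j \<le> i} \<subset> {i. i \<le> j}" using that by fastforce
qed simp

lemma inj_position: "inj position"
  by (metis injI linorder_neqE position_less less_irrefl)

lemma position_eq_iff [simp]: "position i = position j \<longleftrightarrow> i = j"
  using inj_position by (auto dest: injD)

lemma position_ge_1: "1 \<le> position i"
proof -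
  have "card {j. j \<le> i} \<noteq> 0" by auto
  then show ?thesis by (simp only: position_def)
qed

lemma position_le: "position (i::'a::{finite,linorder}) \<le> CARD('a)"
  unfolding position_def by (rule card_mono) auto

lemma bij_betw_position:
  "bij_betw position (UNIV :: 'a::{finite,linorder} set) {1..CARD('a)}"
proof -
  have "range (position :: 'a \<Rightarrow> nat) \<subseteq> {1..CARD('a)}"
    using position_ge_1 position_le by auto
  moreover have "card (range (position :: 'a \<Rightarrow> nat)) = CARD('a)"
    by (simp add: card_image inj_position)
  ultimately have "range (position :: 'a \<Rightarrow> nat) = {1..CARD('a)}"
    by (simp add: card_subset_eq)
  then show ?thesis by (simp add: bij_betw_def inj_position)
qed

lemma ex_position:
  assumes "1 \<le> p" "p \<le> CARD('a::{finite,linorder})"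
  obtains i :: "'a::{finite,linorder}" where "position i = p"
  proof -
  have "p \<in> range (position :: 'a \<Rightarrow> nat)"
    using assms bij_betw_position[where 'a='a] by (simp add: bij_betw_def)
  then show ?thesis using that by auto
qed

lemma the_position [simp]: "(THE c. position c = position i) = i"
  by (rule the_equality) auto

text \<open>Sums over index types of different sizes become sums over intervals of naturals, where
  they can be compared.\<close>

lemma sum_position:
  "(\<Sum>i\<in>UNIV. h (position (i :: 'a::{finite,linorder}))) = (\<Sum>p = 1..CARD('a). h p)"
  using sum.reindex_bij_betw[OF bij_betw_position] .

section \<open>Rectangular diagonal matrices\<close>

lemma rect_diag_vector_nth: "(rect_diag f *v x) $ i = f (position i) * x $ i"
  by (simp add: rect_diag_def matrix_vector_mult_def if_distrib[of "\<lambda>a. a * _"]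
      sum.delta cong: if_cong)

lemma rect_diag_mult:
  "rect_diag f ** (rect_diag g :: real ^ 'a::{finite,linorder} ^ 'a::{finite,linorder})
     = (rect_diag (\<lambda>i. f i * g i) :: real ^ 'a::{finite,linorder} ^ 'a::{finite,linorder})"
  by (simp add: matrix_eq vec_eq_iff rect_diag_vector_nth mult.assoc flip: matrix_vector_mul_assoc)

text \<open>If there are more rows than columns, the rows beyond the last column are zero in the
  product. The assumption makes the right-hand side vanish there as well.\<close>

lemma rect_diag_mult_transpose:
  assumes "\<And>i. i > CARD('c::{finite,linorder}) \<Longrightarrow> s i = 0"
  shows "(rect_diag s :: real ^ 'c::{finite,linorder} ^ 'r::{finite,linorder})
           ** transpose (rect_diag s :: real ^ 'c::{finite,linorder} ^ 'r::{finite,linorder}) = rect_diag (\<lambda>i. (s i)\<^sup>2)"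
proof -
  have "(\<Sum>c\<in>UNIV. (if position i = position (c :: 'c) then s (position i) else 0)
           * (if position j = position c then s (position j) else 0))
        = (if i = j then (s (position i))\<^sup>2 else 0)" (is "?l = ?r") for i j :: 'r
  proof -
    have "?l = (\<Sum>p = 1..CARD('c). (if position i = p then s (position i) else 0)
           * (if position j = p then s (position j) else 0))"
      by (rule sum_position)
    also have "\<dots> = (\<Sum>p = 1..CARD('c). if position i = p then
            (if i = j then (s (position i))\<^sup>2 else 0) else 0)"
      by (rule sum.cong) (auto simp: power2_eq_square)
    also have "\<dots> = ?r"
      using assms[of "position i"] position_ge_1[of i] by (auto simp: sum.delta)
    finally show ?thesis .
  qed
  then show ?thesis
    by (simp add: rect_diag_def matrix_matrix_mult_def transpose_def vec_eq_iff)
qed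

section \<open>Symmetric matrices given by columns and weights\<close>

text \<open>For orthogonal \<open>U\<close> this is the matrix with eigenvectors the columns of
  \<open>U\<close> and eigenvalues \<open>f\<close>. Allowing rectangular \<open>U\<close> covers
  the truncated products in the theorem too.\<close>

definition spectral ::
    "real ^ 'c::{finite,linorder} ^ 'r::{finite,linorder} \<Rightarrow> (nat \<Rightarrow> real) \<Rightarrow> real ^ 'r::{finite,linorder} ^ 'r::{finite,linorder}" where
  "spectral U f = U ** rect_diag f ** transpose U"

lemma spectral_nth: "spectral U f $ x $ y = (\<Sum>c\<in>UNIV. U $ x $ c * f (position c) * U $ y $ c)"
  by (simp add: spectral_def matrix_matrix_mult_def rect_diag_def transpose_def
      if_distrib[of "\<lambda>a. _ * a"] sum.delta cong: if_cong)

lemma spectral_cong: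
  assumes "\<And>i. 1 \<le> i \<Longrightarrow> i \<le> CARD('c::{finite,linorder}) \<Longrightarrow> f i = g i"
  shows "spectral (U :: real ^ 'c::{finite,linorder} ^ 'r::{finite,linorder}) f = spectral U g"
  by (auto simp: vec_eq_iff spectral_nth assms position_le position_ge_1[simplified])

lemma spectral_diff: "spectral U f - spectral U g = spectral U (\<lambda>i. f i - g i)"
  by (simp add: vec_eq_iff spectral_nth algebra_simps sum_subtractf)

lemma transpose_spectral: "transpose (spectral U f) = spectral U f"
  by (simp add: vec_eq_iff transpose_def spectral_nth mult_ac)

text \<open>Dropping columns amounts to giving them weight zero, so truncated matrices can be
  multiplied and compared inside the calculus of the full orthogonal matrix.\<close>

lemma spectral_first_columns:
  fixes U :: "real ^ 'r::{finite,linorder} ^ 'r::{finite,linorder}"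
  assumes "CARD('k::{finite,linorder}) \<le> CARD('r::{finite,linorder})"
  shows "spectral (first_columns U :: real ^ 'k::{finite,linorder} ^ 'r::{finite,linorder}) f
           = spectral U (\<lambda>i. if i \<le> CARD('k::{finite,linorder}) then f i else 0)"
proof -
  have "spectral (first_columns U :: real ^ 'k::{finite,linorder} ^ 'r::{finite,linorder}) f $ x $ y
      = spectral U (\<lambda>i. if i \<le> CARD('k) then f i else 0) $ x $ y" for x y
  proof -
    \<comment> \<open>Indexing the summands by naturals lets the sums over \<open>'k\<close> and
      \<open>'r\<close> share one function.\<close>
    define h where "h p = U $ x $ (THE c. position c = p) * f p * U $ y $ (THE c. position c = p)"
      for p
    have "spectral (first_columns U :: real ^ 'k::{finite,linorder} ^ 'r::{finite,linorder}) f $ x $ y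
        = (\<Sum>c\<in>UNIV. h (position (c :: 'k)))"
      by (simp add: spectral_nth first_columns_def h_def)
    also have "\<dots> = (\<Sum>p = 1..CARD('k). h p)"
      by (rule sum_position)
    also have "\<dots> = (\<Sum>p = 1..CARD('r). if p \<le> CARD('k) then h p else 0)"
      using assms by (intro sum.mono_neutral_cong_left) auto
    also have "\<dots> = (\<Sum>c\<in>UNIV. if position (c :: 'r) \<le> CARD('k) then h (position c) else 0)"
      by (rule sum_position[symmetric])
    also have "\<dots> = spectral U (\<lambda>i. if i \<le> CARD('k) then f i else 0) $ x $ y"
      unfolding spectral_nth by (rule sum.cong) (auto simp: h_def)
    finally show ?thesis .
  qed
  then show ?thesis by (simp add: vec_eq_iff)
qed

text \<open>The factor \<open>V\<close> cancels by orthogonality, so the squared singular values are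
  the eigenvalues of the Gram matrix.\<close>

lemma svd_gram:
  assumes "is_svd (A :: real ^ 'c::{finite,linorder} ^ 'r::{finite,linorder}) U s V"
  shows "A ** transpose A = spectral U (\<lambda>i. (s i)\<^sup>2)"
proof -
  have A: "A = U ** rect_diag s ** transpose V" and V: "transpose V ** V = mat 1"
    and s: "(rect_diag s :: real ^ 'c::{finite,linorder} ^ 'r::{finite,linorder}) ** transpose (rect_diag s :: real ^ 'c::{finite,linorder} ^ 'r::{finite,linorder}) = rect_diag (\<lambda>i. (s i)\<^sup>2)"
    using assms
    by (auto simp: is_svd_def orthogonal_matrix_def intro!: rect_diag_mult_transpose)
  have "A ** transpose A
      = U ** (rect_diag s ** (transpose V ** V) ** transpose (rect_diag s)) ** transpose U"
    by (simp add: A matrix_transpose_mul matrix_mul_assoc)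
  then show ?thesis by (simp add: V s spectral_def)
qed

lemma svd_antimono:
  assumes "is_svd A U s V" "1 \<le> i" "i \<le> j"
  shows "(s j)\<^sup>2 \<le> (s i)\<^sup>2"
proof -
  have "s j \<le> s i" using assms(3)
  proof (induction j rule: dec_induct)
    case (step m)
    then have "s (Suc m) \<le> s m" using assms(1,2) by (auto simp: is_svd_def)
    with step.IH show ?case by simp
  qed simp
  moreover have "0 \<le> s j" using assms by (auto simp: is_svd_def)
  ultimately show ?thesis by (rule power_mono)
qed

section \<open>Functional calculus for a fixed orthogonal matrix\<close>

context
  fixes U :: "real ^ 'n::{finite,linorder} ^ 'n::{finite,linorder}"
  assumes U: "orthogonal_matrix U"
begin

lemma spectral_mult: "spectral U f ** spectral U g = spectral U (\<lambda>i. f i * g i)"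
proof -
  have "spectral U f ** spectral U g
      = U ** (rect_diag f ** (transpose U ** U) ** rect_diag g) ** transpose U"
    by (simp add: spectral_def matrix_mul_assoc)
  then show ?thesis
    using U by (simp add: orthogonal_matrix_def rect_diag_mult spectral_def)
qed

lemma spectral_1: "spectral U (\<lambda>_. 1) = mat 1"
proof -
  have "rect_diag (\<lambda>_. 1) = (mat 1 :: real ^ 'n::{finite,linorder} ^ 'n::{finite,linorder})"
    by (simp add: rect_diag_def mat_def)
  then show ?thesis
    using U by (simp add: orthogonal_matrix_def spectral_def)
qed

lemma opnorm_spectral_le:
  assumes "\<And>i. 1 \<le> i \<Longrightarrow> i \<le> CARD('n) \<Longrightarrow> \<bar>f i\<bar> \<le> c"
  shows "opnorm (spectral U f) \<le> c"
proof (rule onorm_le)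
  fix x
  let ?y = "transpose U *v x"
  \<comment> \<open>The index type is nonempty, so the bound on \<open>f\<close> at any one position
    forces \<open>c\<close> to be nonnegative.\<close>
  obtain i :: 'n where True by simp
  then have c: "0 \<le> c"
    using assms[OF position_ge_1[of i] position_le] by linarith
  have "norm (spectral U f *v x) = norm ((rect_diag f :: real ^ 'n::{finite,linorder} ^ 'n::{finite,linorder}) *v ?y)"
    by (simp add: spectral_def norm_orthogonal[OF U] del: transpose_matrix_vector
        flip: matrix_vector_mul_assoc)
  also have "\<dots> \<le> norm (c *\<^sub>R ?y)"
    by (rule norm_le_componentwise_cart)
      (use assms position_le position_ge_1 in
        \<open>force simp: rect_diag_vector_nth abs_mult c intro!: mult_right_mono\<close>)
  finally show "norm (spectral U f *v x) \<le> c * norm x"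
    using c by (simp add: norm_transpose_orthogonal[OF U] del: transpose_matrix_vector)
qed

lemma inner_spectral:
  "x \<bullet> (spectral U f *v x) = (\<Sum>c\<in>UNIV. f (position c) * ((transpose U *v x) $ c)\<^sup>2)"
proof -
  have "x \<bullet> (spectral U f *v x) = (transpose U *v x) \<bullet> (rect_diag f *v (transpose U *v x))"
    by (simp add: spectral_def dot_lmul_matrix flip: matrix_vector_mul_assoc)
  then show ?thesis
    by (simp add: inner_vec_def rect_diag_vector_nth power2_eq_square mult_ac)
qed

lemma norm_sum_coordinates: "(norm x)\<^sup>2 = (\<Sum>c\<in>UNIV. ((transpose U *v x) $ c)\<^sup>2)"
proof -
  have "(norm x)\<^sup>2 = (norm (transpose U *v x))\<^sup>2"
    by (simp only: norm_transpose_orthogonal[OF U])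
  then show ?thesis
    by (simp only: power2_norm_eq_inner inner_vec_def) (simp add: power2_eq_square)
qed

end

section \<open>Weyl's inequality for eigenvalues\<close>

text \<open>Some nonzero \<open>x\<close> has only its first \<open>i\<close> coordinates in the
  basis \<open>U\<close>, and only those from the \<open>i\<close>-th on in the basis
  \<open>W\<close>. Its two quadratic forms are then at least \<open>f i\<close> and at most
  \<open>g i\<close> times the squared norm of \<open>x\<close>, and they differ by at most
  \<epsilon> times it.\<close>

lemma weyl_le:
  fixes U W :: "real ^ 'n::{finite,linorder} ^ 'n::{finite,linorder}"
  assumes U: "orthogonal_matrix U" and W: "orthogonal_matrix W"
    and f: "\<And>p q. 1 \<le> p \<Longrightarrow> p \<le> q \<Longrightarrow> f q \<le> f p"
    and g: "\<And>p q. 1 \<le> p \<Longrightarrow> p \<le> q \<Longrightarrow> g q \<le> g p"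
    and eps: "opnorm (spectral U f - spectral W g) \<le> \<epsilon>"
    and i: "1 \<le> i" "i \<le> CARD('n)"
  shows "f i \<le> g i + \<epsilon>"
proof -
  obtain i' :: 'n where i': "position i' = i" using ex_position i by blast
  \<comment> \<open>Fewer than \<open>CARD('n)\<close> linear conditions put \<open>x\<close> into the span of the first \<open>i\<close> columns of \<open>U\<close>
    and into that of the columns of \<open>W\<close> from the \<open>i\<close>-th on.\<close>
  define S where "S = (\<lambda>c. column c U) ` {c. i < position c} \<union> (\<lambda>c. column c W) ` {c. position c < i}"
  have "card S \<le> card {c :: 'n. i < position c} + card {c :: 'n. position c < i}"
    unfolding S_def by (intro order.trans[OF card_Un_le] add_mono card_image_le) auto
  \<comment> \<open>The two index sets are disjoint and both omit \<open>i'\<close>, hence the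
    strict bound.\<close>
  also have "\<dots> = card ({c :: 'n. i < position c} \<union> {c :: 'n. position c < i})"
    by (rule card_Un_disjoint[symmetric]) auto
  also have "\<dots> < CARD('n)"
    by (rule psubset_card_mono) (use i' in auto)
  finally have "dim S < DIM(real ^ 'n::{finite,linorder})"
    using dim_le_card'[of S] by (simp add: S_def)
  then obtain x where x0: "x \<noteq> 0" and x: "\<And>y. y \<in> span S \<Longrightarrow> orthogonal x y"
    using orthogonal_to_subspace_exists by blast
  have coord: "(transpose M *v x) $ c = column c M \<bullet> x" for M :: "real ^ 'n::{finite,linorder} ^ 'n::{finite,linorder}" and c
    by (simp add: matrix_vector_mult_def transpose_def column_def inner_vec_def)
  have xU: "(transpose U *v x) $ c = 0" if "i < position c" for c
    unfolding coord using x[OF span_base, of "column c U"] that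
    by (force simp: orthogonal_def inner_commute S_def)
  have xW: "(transpose W *v x) $ c = 0" if "position c < i" for c
    unfolding coord using x[OF span_base, of "column c W"] that
    by (force simp: orthogonal_def inner_commute S_def)
  have "f i * (norm x)\<^sup>2 \<le> x \<bullet> (spectral U f *v x)"
    unfolding inner_spectral[OF U] norm_sum_coordinates[OF U] sum_distrib_left
  proof (rule sum_mono)
    fix c :: 'n
    show "f i * ((transpose U *v x) $ c)\<^sup>2 \<le> f (position c) * ((transpose U *v x) $ c)\<^sup>2"
      using xU[of c] f[OF position_ge_1, of c i]
      by (cases "i < position c") (auto intro: mult_right_mono)
  qed
  also have "x \<bullet> (spectral U f *v x)
      = x \<bullet> (spectral W g *v x) + x \<bullet> ((spectral U f - spectral W g) *v x)"
    by (simp add: matrix_vector_mult_diff_rdistrib inner_diff_right)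
  also have "\<dots> \<le> g i * (norm x)\<^sup>2 + \<epsilon> * (norm x)\<^sup>2"
  proof (rule add_mono)
    show "x \<bullet> (spectral W g *v x) \<le> g i * (norm x)\<^sup>2"
      unfolding inner_spectral[OF W] norm_sum_coordinates[OF W] sum_distrib_left
    proof (rule sum_mono)
      fix c :: 'n
      show "g (position c) * ((transpose W *v x) $ c)\<^sup>2 \<le> g i * ((transpose W *v x) $ c)\<^sup>2"
        using xW[of c] g[OF i(1), of "position c"]
        by (cases "position c < i") (auto intro: mult_right_mono)
    qed
    have "x \<bullet> ((spectral U f - spectral W g) *v x)
        \<le> norm x * norm ((spectral U f - spectral W g) *v x)"
      by (rule norm_cauchy_schwarz)
    also have "\<dots> \<le> norm x * (\<epsilon> * norm x)"
      by (intro mult_left_mono order.trans[OF opnorm_bound] mult_right_mono eps) auto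
    finally show "x \<bullet> ((spectral U f - spectral W g) *v x) \<le> \<epsilon> * (norm x)\<^sup>2"
      by (simp add: power2_eq_square mult_ac)
  qed
  finally have "f i * (norm x)\<^sup>2 \<le> (g i + \<epsilon>) * (norm x)\<^sup>2"
    by (simp add: algebra_simps)
  then show ?thesis using x0 by simp
qed

section \<open>A Davis-Kahan bound for products of spectral projections\<close>

text \<open>On the range of the first projection \<open>spectral U f\<close> is inverted with norm
  at most \<open>1 / f k\<close>; on that of the second \<open>spectral W g\<close> has norm at most
  \<open>g (Suc k)\<close>. Writing \<open>P ** Q\<close> through both matrices gives an inequality
  with \<open>opnorm (P ** Q)\<close> on both sides, which is solved for it.\<close>

lemma spectral_gap_projections:
  fixes U W :: "real ^ 'n::{finite,linorder} ^ 'n::{finite,linorder}"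
  assumes U: "orthogonal_matrix U" and W: "orthogonal_matrix W"
    and f: "\<And>p q. 1 \<le> p \<Longrightarrow> p \<le> q \<Longrightarrow> f q \<le> f p"
    and g: "\<And>p q. 1 \<le> p \<Longrightarrow> p \<le> q \<Longrightarrow> g q \<le> g p"
    and g_nonneg: "\<And>p. 1 \<le> p \<Longrightarrow> 0 \<le> g p"
    and eps: "opnorm (spectral U f - spectral W g) \<le> \<epsilon>"
    and k: "1 \<le> k" and gap: "g (Suc k) < f k"
  shows "opnorm (spectral U (\<lambda>i. if i \<le> k then 1 else 0)
                   ** spectral W (\<lambda>i. if i \<le> k then 0 else 1)) \<le> \<epsilon> / (f k - g (Suc k))"
proof -
  define P where "P = spectral U (\<lambda>i. if i \<le> k then 1 else 0)"
  define Q where "Q = spectral W (\<lambda>i. if i \<le> k then 0 else 1)"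
  define M where "M = spectral U (\<lambda>i. if i \<le> k then 1 / f i else 0)"
  define G where "G = spectral W (\<lambda>i. if i \<le> k then 0 else g i)"
  define E where "E = spectral U f - spectral W g"
  have gk: "0 \<le> g (Suc k)" using g_nonneg by simp
  then have fk: "0 < f k" using gap by linarith
  have fpos: "0 < f p" if "1 \<le> p" "p \<le> k" for p using f[OF that] fk by linarith
  have P: "P = M ** (P ** spectral U f)"
    unfolding P_def M_def spectral_mult[OF U]
    by (rule spectral_cong) (use fpos in \<open>force\<close>)
  have PP: "P ** P = P" and QQ: "Q ** Q = Q" and G: "spectral W g ** Q = Q ** G"
    unfolding P_def Q_def G_def spectral_mult[OF U] spectral_mult[OF W]
    by (auto intro!: spectral_cong)
  have "P ** Q = M ** (P ** spectral U f) ** Q"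
    using P by simp
  also have "\<dots> = M ** (P ** E ** Q + P ** Q ** G)"
  proof -
    \<comment> \<open>Since \<open>Q\<close> commutes with \<open>spectral W g\<close>, exchanging
      the two matrices next to \<open>Q\<close> costs only the error \<open>E\<close>.\<close>
    have "spectral U f ** Q = E ** Q + Q ** G"
      by (simp add: E_def matrix_diff_rdistrib flip: G)
    then show ?thesis by (simp add: matrix_add_ldistrib flip: matrix_mul_assoc)
  qed
  finally have eq: "P ** Q = M ** (P ** E ** Q + P ** Q ** G)" .
  have nP: "opnorm P \<le> 1" unfolding P_def by (rule opnorm_spectral_le[OF U]) auto
  have nQ: "opnorm Q \<le> 1" unfolding Q_def by (rule opnorm_spectral_le[OF W]) auto
  have nM: "opnorm M \<le> 1 / f k" unfolding M_def
    by (rule opnorm_spectral_le[OF U]) (use fk fpos f in \<open>auto simp: abs_of_pos intro!: frac_le\<close>)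
  have nG: "opnorm G \<le> g (Suc k)" unfolding G_def
    by (rule opnorm_spectral_le[OF W]) (use gk g_nonneg g in \<open>auto\<close>)
  have nE: "opnorm E \<le> \<epsilon>" using eps by (simp add: E_def)
  have "opnorm (P ** E ** Q + P ** Q ** G) \<le> 1 * \<epsilon> * 1 + opnorm (P ** Q) * g (Suc k)"
    by (intro order.trans[OF opnorm_add] add_mono opnorm_mult_le nP nE nQ nG order.refl)
  from opnorm_mult_le[OF nM this]
  have "opnorm (P ** Q) \<le> 1 / f k * (\<epsilon> + opnorm (P ** Q) * g (Suc k))"
    by (simp flip: eq)
  then have "opnorm (P ** Q) * (f k - g (Suc k)) \<le> \<epsilon>"
    using fk by (simp add: field_simps)
  then show ?thesis
    using gap by (simp add: P_def Q_def field_simps)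
qed

section \<open>Perturbation of truncated inverses\<close>

text \<open>In the bound, the first summand collects two equal contributions: the error
  \<open>M ** E ** N\<close> and the replacement of \<open>g\<close> by \<open>f\<close> in the
  weights. The second summand comes from the two mixed products of projections.\<close>

lemma truncated_inverse_perturbation:
  fixes U W :: "real ^ 'n::{finite,linorder} ^ 'n::{finite,linorder}"
  assumes U: "orthogonal_matrix U" and W: "orthogonal_matrix W"
    and f: "\<And>p q. 1 \<le> p \<Longrightarrow> p \<le> q \<Longrightarrow> f q \<le> f p"
    and g: "\<And>p q. 1 \<le> p \<Longrightarrow> p \<le> q \<Longrightarrow> g q \<le> g p"
    and f_nonneg: "\<And>p. 1 \<le> p \<Longrightarrow> 0 \<le> f p"
    and g_nonneg: "\<And>p. 1 \<le> p \<Longrightarrow> 0 \<le> g p"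
    and eps: "opnorm (spectral U f - spectral W g) \<le> \<epsilon>"
    and k: "1 \<le> k" "k < CARD('n)"
    and gap: "\<epsilon> < f k - f (Suc k)"
  shows "opnorm (spectral U (\<lambda>i. if i \<le> k then 1 / f i else 0)
                  - spectral W (\<lambda>i. if i \<le> k then 1 / f i else 0))
          \<le> 2 * \<epsilon> / (f k * (f k - \<epsilon>))
            + (1 / f k + 1 / (f k - \<epsilon>)) * (\<epsilon> / (f k - f (Suc k) - \<epsilon>))"
proof -
  define P where "P = spectral U (\<lambda>i. if i \<le> k then 1 else 0)"
  define P' where "P' = spectral U (\<lambda>i. if i \<le> k then 0 else 1)"
  define Q where "Q = spectral W (\<lambda>i. if i \<le> k then 1 else 0)"
  define Q' where "Q' = spectral W (\<lambda>i. if i \<le> k then 0 else 1)"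
  define M where "M = spectral U (\<lambda>i. if i \<le> k then 1 / f i else 0)"
  define N where "N = spectral W (\<lambda>i. if i \<le> k then 1 / g i else 0)"
  define L where "L = spectral W (\<lambda>i. if i \<le> k then 1 / f i else 0)"
  define E where "E = spectral U f - spectral W g"
  \<comment> \<open>By Weyl's inequality both \<open>f k - g (Suc k)\<close> and
    \<open>g k - f (Suc k)\<close> are at least this denominator, so \<eta> bounds both mixed
    products.\<close>
  define \<eta> where "\<eta> = \<epsilon> / (f k - f (Suc k) - \<epsilon>)"
  have nE: "opnorm E \<le> \<epsilon>" using eps by (simp add: E_def)
  have eps': "opnorm (spectral W g - spectral U f) \<le> \<epsilon>"
    using eps by (simp add: opnorm_minus_commute)
  have e0: "0 \<le> \<epsilon>" using opnorm_nonneg eps by (rule order.trans)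
  have fS: "0 \<le> f (Suc k)" using f_nonneg by simp
  have fk: "\<epsilon> < f k" using gap fS by linarith
  have fg: "f p \<le> g p + \<epsilon>" and gf: "g p \<le> f p + \<epsilon>" if "1 \<le> p" "p \<le> CARD('n)" for p
    using weyl_le[of U W f g, OF U W f g eps that] weyl_le[of W U g f, OF W U g f eps' that] by auto
  have fk': "f k \<le> f p" and gk': "f k - \<epsilon> \<le> g p" if "1 \<le> p" "p \<le> k" for p
    using f[OF that] fg[of p] that k by auto
  have gk: "f k - \<epsilon> \<le> g k" and gS: "g (Suc k) \<le> f (Suc k) + \<epsilon>"
    using fg[of k] gf[of "Suc k"] k by auto
  have "opnorm (P ** Q') \<le> \<epsilon> / (f k - g (Suc k))"
    unfolding P_def Q'_def
    by (rule spectral_gap_projections[OF U W f g g_nonneg eps k(1)]) (use gS gap in auto)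
  also have "\<dots> \<le> \<eta>"
    unfolding \<eta>_def by (rule divide_left_mono) (use gS gap e0 in auto)
  finally have PQ': "opnorm (P ** Q') \<le> \<eta>" .
  \<comment> \<open>Transposition puts the top projection first, so that the projection bound
    applies with the two matrices exchanged.\<close>
  have "opnorm (P' ** Q) = opnorm (Q ** P')"
    by (subst opnorm_transpose[symmetric])
      (simp add: matrix_transpose_mul P'_def Q_def transpose_spectral)
  also have "\<dots> \<le> \<epsilon> / (g k - f (Suc k))"
    unfolding P'_def Q_def
    by (rule spectral_gap_projections[OF W U g f f_nonneg eps' k(1)]) (use gk gap in auto)
  also have "\<dots> \<le> \<eta>"
    unfolding \<eta>_def by (rule divide_left_mono) (use gk gap e0 in auto)
  finally have P'Q: "opnorm (P' ** Q) \<le> \<eta>" .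
  have nM: "opnorm M \<le> 1 / f k" unfolding M_def
    by (rule opnorm_spectral_le[OF U]) (use fk e0 fk' in \<open>force intro!: divide_left_mono\<close>)
  have nN: "opnorm N \<le> 1 / (f k - \<epsilon>)" unfolding N_def
    by (rule opnorm_spectral_le[OF W]) (use fk e0 gk' in \<open>force intro!: divide_left_mono\<close>)
  have nNL: "opnorm (N - L) \<le> \<epsilon> / (f k * (f k - \<epsilon>))"
    unfolding N_def L_def spectral_diff
  proof (rule opnorm_spectral_le[OF W])
    fix p assume p: "1 \<le> p" "p \<le> CARD('n)"
    show "\<bar>(if p \<le> k then 1 / g p else 0) - (if p \<le> k then 1 / f p else 0)\<bar>
        \<le> \<epsilon> / (f k * (f k - \<epsilon>))"
    proof (cases "p \<le> k")
      case True
      have pos: "0 < f p" "0 < g p" using fk'[OF p(1) True] gk'[OF p(1) True] fk e0 by auto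
      then have "\<bar>1 / g p - 1 / f p\<bar> = \<bar>f p - g p\<bar> / (f p * g p)"
        by (simp add: diff_frac_eq abs_divide abs_mult mult.commute)
      also have "\<dots> \<le> \<epsilon> / (f k * (f k - \<epsilon>))"
        by (rule frac_le)
          (use fg[OF p] gf[OF p] fk'[OF p(1) True] gk'[OF p(1) True] fk e0 pos in
            \<open>auto intro!: mult_mono\<close>)
      finally show ?thesis using True by simp
    qed (use fk e0 in auto)
  qed
  have fpos: "0 < f p" and gpos: "0 < g p" if "1 \<le> p" "p \<le> k" for p
    using fk'[OF that] gk'[OF that] fk e0 by auto
  have MB: "M ** spectral U f = P" and MP: "M ** P = M" and PM: "P ** M = M"
    unfolding M_def P_def spectral_mult[OF U]
    by (rule spectral_cong; use fpos in force)+
  have BN: "spectral W g ** N = Q" and QN: "Q ** N = N"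
    unfolding N_def Q_def spectral_mult[OF W]
    by (rule spectral_cong; use gpos in force)+
  have P': "P' = mat 1 - P"
    unfolding P_def P'_def spectral_1[OF U, symmetric] spectral_diff by (rule spectral_cong) simp
  have Q': "Q' = mat 1 - Q"
    unfolding Q_def Q'_def spectral_1[OF W, symmetric] spectral_diff by (rule spectral_cong) simp
  \<comment> \<open>In the combination of this identity with the next two, \<open>M ** Q\<close> and
    \<open>P ** N\<close> cancel and leave \<open>M - N\<close>.\<close>
  have "M ** E ** N = P ** N - M ** Q"
    by (simp add: E_def matrix_diff_rdistrib matrix_diff_ldistrib MB BN flip: matrix_mul_assoc)
  moreover have "M ** (P ** Q') = M - M ** Q"
    by (simp add: Q' matrix_diff_ldistrib matrix_mul_assoc MP)
  moreover have "P' ** Q ** N = N - P ** N"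
    by (simp add: P' matrix_diff_rdistrib QN flip: matrix_mul_assoc)
  ultimately have "M - L = (M ** (P ** Q') - M ** E ** N) - P' ** Q ** N + (N - L)"
    by simp
  also have "opnorm \<dots> \<le> (1 / f k * \<eta> + 1 / f k * \<epsilon> * (1 / (f k - \<epsilon>))) + \<eta> * (1 / (f k - \<epsilon>))
      + \<epsilon> / (f k * (f k - \<epsilon>))"
    by (intro order.trans[OF opnorm_add] order.trans[OF opnorm_diff] add_mono opnorm_mult_le
        nM nN nE nNL PQ' P'Q)
  also have "\<dots> = 2 * \<epsilon> / (f k * (f k - \<epsilon>)) + (1 / f k + 1 / (f k - \<epsilon>)) * \<eta>"
    by (simp add: algebra_simps)
  finally show ?thesis by (simp add: M_def L_def \<eta>_def)
qed

section \<open>Numerical estimate of the bound\<close>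

text \<open>Here \<alpha> stands for the \<open>k\<close>-th eigenvalue, \<gamma> for the gap below
  it and \<delta> for the cube root in the theorem. As \<delta> is bounded away from 1, its higher
  powers are absorbed into small multiples of \<delta>.\<close>

lemma perturbation_bound_numeric:
  fixes \<alpha> \<epsilon> \<gamma> \<delta> :: real
  assumes "0 < \<alpha>" "0 \<le> \<epsilon>" "0 < \<gamma>" "0 \<le> \<delta>"
    and t: "\<epsilon> \<le> \<delta> ^ 3 * \<alpha>" and s: "\<epsilon> \<le> \<delta>\<^sup>2 * \<gamma>" and d: "\<delta> ^ 3 \<le> 1 / 20"
  shows "\<epsilon> < \<gamma>"
    and "2 * \<epsilon> / (\<alpha> * (\<alpha> - \<epsilon>)) + (1 / \<alpha> + 1 / (\<alpha> - \<epsilon>)) * (\<epsilon> / (\<gamma> - \<epsilon>)) \<le> 8 / \<alpha> * \<delta>"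
proof -
  have d25: "\<delta> \<le> 2/5"
  proof (rule ccontr)
    assume "\<not> \<delta> \<le> 2/5"
    \<comment> \<open>The cube of 2/5 is 8/125, which exceeds 1/20.\<close>
    then have "(2/5) ^ 3 \<le> \<delta> ^ 3" by (intro power_mono) auto
    then show False using d by (simp add: power3_eq_cube)
  qed
  have d2: "\<delta>\<^sup>2 \<le> 2/5 * \<delta>"
    using mult_right_mono[OF d25 \<open>0 \<le> \<delta>\<close>] by (simp add: power2_eq_square)
  have d3: "\<delta> ^ 3 \<le> 4/25 * \<delta>"
    using mult_right_mono[OF d2 \<open>0 \<le> \<delta>\<close>] d2 by (simp add: power2_eq_square power3_eq_cube)
  have "\<delta>\<^sup>2 \<le> 4/25" using d2 d25 by linarith
  then have e_gam: "\<epsilon> \<le> 4/25 * \<gamma>"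
    using s mult_right_mono[of "\<delta>\<^sup>2" "4/25" \<gamma>] \<open>0 < \<gamma>\<close> by linarith
  then show "\<epsilon> < \<gamma>" using \<open>0 < \<gamma>\<close> by linarith
  have e_lam: "\<epsilon> \<le> 1/20 * \<alpha>"
    using t mult_right_mono[OF d, of \<alpha>] \<open>0 < \<alpha>\<close> by linarith
  have l: "19/20 * \<alpha> \<le> \<alpha> - \<epsilon>" using e_lam by linarith
  have lpos: "0 < \<alpha> - \<epsilon>" using l \<open>0 < \<alpha>\<close> by linarith
  have inv: "1 / (\<alpha> - \<epsilon>) \<le> 2 / \<alpha>"
    using l \<open>0 < \<alpha>\<close> lpos by (simp add: field_simps)
  \<comment> \<open>The factor 21/25 is 1 - 4/25, from \<open>e_gam\<close>.\<close>
  have "\<epsilon> / (\<gamma> - \<epsilon>) \<le> \<epsilon> / (21/25 * \<gamma>)"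
    by (rule divide_left_mono) (use e_gam \<open>0 < \<gamma>\<close> \<open>0 \<le> \<epsilon>\<close> in auto)
  also have "\<dots> \<le> 25/21 * \<delta>\<^sup>2"
    using s \<open>0 < \<gamma>\<close> by (simp add: field_simps)
  also have "\<dots> \<le> 10/21 * \<delta>" using d2 by linarith
  finally have a: "\<epsilon> / (\<gamma> - \<epsilon>) \<le> \<delta>" using \<open>0 \<le> \<delta>\<close> by linarith
  have "(1 / \<alpha> + 1 / (\<alpha> - \<epsilon>)) * (\<epsilon> / (\<gamma> - \<epsilon>)) \<le> (3 / \<alpha>) * \<delta>"
    by (rule mult_mono) (use a inv \<open>0 < \<alpha>\<close> \<open>0 \<le> \<epsilon>\<close> \<open>\<epsilon> < \<gamma>\<close> in auto)
  moreover have "2 * \<epsilon> / (\<alpha> * (\<alpha> - \<epsilon>)) \<le> 4 / \<alpha> * \<delta>"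
  proof -
    have "\<epsilon> / \<alpha> \<le> \<delta>" 
    proof -
      have "\<delta> ^ 3 \<le> \<delta>" using d3 \<open>0 \<le> \<delta>\<close> by linarith
      then have "\<delta> ^ 3 * \<alpha> \<le> \<delta> * \<alpha>" using \<open>0 < \<alpha>\<close> by (intro mult_right_mono) auto
      with t have "\<epsilon> \<le> \<delta> * \<alpha>" by linarith
      then show ?thesis using \<open>0 < \<alpha>\<close> by (simp add: pos_divide_le_eq)
    qed
    then have "2 * (\<epsilon> / \<alpha> * (1 / (\<alpha> - \<epsilon>))) \<le> 2 * (\<delta> * (2 / \<alpha>))"
      by (intro mult_left_mono mult_mono) (use inv lpos \<open>0 \<le> \<delta>\<close> in auto)
    then show ?thesis by (simp add: mult_ac)
  qed
  \<comment> \<open>The two parts add up to 7, within the constant 8.\<close>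
  ultimately have "2 * \<epsilon> / (\<alpha> * (\<alpha> - \<epsilon>)) + (1 / \<alpha> + 1 / (\<alpha> - \<epsilon>)) * (\<epsilon> / (\<gamma> - \<epsilon>)) \<le> 4 / \<alpha> * \<delta> + 3 / \<alpha> * \<delta>"
    by linarith
  also have "\<dots> \<le> 8 / \<alpha> * \<delta>" using \<open>0 < \<alpha>\<close> \<open>0 \<le> \<delta>\<close> by (simp add: field_simps)
  finally show "2 * \<epsilon> / (\<alpha> * (\<alpha> - \<epsilon>)) + (1 / \<alpha> + 1 / (\<alpha> - \<epsilon>)) * (\<epsilon> / (\<gamma> - \<epsilon>)) \<le> 8 / \<alpha> * \<delta>" .
qed

section \<open>From singular values to truncated inverses of the Gram matrices\<close>

theorem theorem6:
  fixes A :: "real ^ 'd::{finite,linorder} ^ 'n::{finite,linorder}"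
    and At :: "real ^ 'l::{finite,linorder} ^ 'n::{finite,linorder}"
    and U Ut :: "real ^ 'n::{finite,linorder} ^ 'n::{finite,linorder}"
    and V :: "real ^ 'd::{finite,linorder} ^ 'd::{finite,linorder}"
    and Vt :: "real ^ 'l::{finite,linorder} ^ 'l::{finite,linorder}"
    and \<sigma> \<sigma>t :: "nat \<Rightarrow> real"
    and k :: nat and \<Delta> \<mu> \<kappa> :: real
    and Uk Utk :: "real ^ 'k::{finite,linorder} ^ 'n::{finite,linorder}"
    and Sk :: "real ^ 'k::{finite,linorder} ^ 'k::{finite,linorder}"
  assumes svd_A: "is_svd A U \<sigma> V"
    and sigma_pos: "\<sigma> CARD('d) > 0"
    and k_def: "k = CARD('k)"
    and k_ge: "1 \<le> k" and k_less: "k < CARD('d)"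
    and Delta_pos: "\<Delta> > 0"
    and gap: "(\<sigma> k)\<^sup>2 - (\<sigma> (k + 1))\<^sup>2 \<ge> \<Delta> * (\<sigma> 1)\<^sup>2"
    and kappa_def: "\<kappa> = (\<sigma> 1)\<^sup>2 / (\<sigma> k)\<^sup>2"
    and close: "onorm (\<lambda>x. (A ** transpose A - At ** transpose At) *v x) \<le> \<mu> * (\<sigma> 1)\<^sup>2"
    and svd_At: "is_svd At Ut \<sigma>t Vt"
    and mu_le: "\<mu> \<le> min (\<Delta> ^ 3 * (real k * \<kappa>)\<^sup>2) (1 / (20 * real k * \<kappa>))"
    and Uk_def: "Uk = first_columns U"
    and Utk_def: "Utk = first_columns Ut"
    and Sk_def: "Sk = rect_diag \<sigma>"
  shows "onorm (\<lambda>x. (Uk ** matrix_inv (Sk ** Sk) ** transpose Uk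
                      - Utk ** matrix_inv (Sk ** Sk) ** transpose Utk) *v x)
          \<le> 8 / (\<sigma> k)\<^sup>2 * (\<mu> * real k * \<kappa>) powr (1 / 3)"
proof -
  define f g where "f i = (\<sigma> i)\<^sup>2" and "g i = (\<sigma>t i)\<^sup>2" for i
  define \<epsilon> where "\<epsilon> = \<mu> * (\<sigma> 1)\<^sup>2"
  define x where "x = \<mu> * real k * \<kappa>"
  define \<delta> where "\<delta> = x powr (1/3)"
  have U: "orthogonal_matrix U" and W: "orthogonal_matrix Ut"
    using svd_A svd_At by (auto simp: is_svd_def)
  \<comment> \<open>Singular values beyond the smaller dimension are zero by convention, so
    positivity of the \<open>d\<close>-th one excludes \<open>n < d\<close>. Hence \<open>U\<close>
    really has \<open>k\<close> columns to select.\<close>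
  have d_le: "CARD('d) \<le> CARD('n)"
  proof (rule ccontr)
    assume "\<not> CARD('d) \<le> CARD('n)"
    then have "\<sigma> CARD('d) = 0" using svd_A by (auto simp: is_svd_def)
    then show False using sigma_pos by simp
  qed
  have fmono: "f q \<le> f p" if "1 \<le> p" "p \<le> q" for p q
    using svd_antimono[OF svd_A that] by (simp add: f_def)
  have gmono: "g q \<le> g p" if "1 \<le> p" "p \<le> q" for p q
    using svd_antimono[OF svd_At that] by (simp add: g_def)
  have fpos: "0 < f p" if "1 \<le> p" "p \<le> k" for p
  proof -
    have "0 < f CARD('d)" using sigma_pos by (simp add: f_def)
    also have "\<dots> \<le> f p" using fmono that k_less by simp
    finally show ?thesis .
  qed
  have f1: "0 < f 1" and fk: "0 < f k" using fpos k_ge by auto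
  have eps: "opnorm (spectral U f - spectral Ut g) \<le> \<epsilon>"
    using close unfolding svd_gram[OF svd_A] svd_gram[OF svd_At] f_def g_def \<epsilon>_def .
  have "0 \<le> \<epsilon>" using opnorm_nonneg eps by (rule order.trans)
  \<comment> \<open>Nonnegativity of \<mu> is forced by the norm bound, because the top eigenvalue
    is positive.\<close>
  then have mu: "0 \<le> \<mu>" using f1 by (simp add: \<epsilon>_def f_def zero_le_mult_iff)
  have kap: "1 \<le> \<kappa>" "\<kappa> * f k = f 1"
    using fmono[of 1 k] k_ge fk by (auto simp: kappa_def f_def)
  have k1: "1 \<le> real k" using k_ge by simp
  have x0: "0 \<le> x" using mu kap by (simp add: x_def)
  have d0: "0 \<le> \<delta>" by (simp add: \<delta>_def)
  have d3: "\<delta> ^ 3 = x"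
    using x0 by (simp add: \<delta>_def powr_powr flip: powr_numeral)
  have "x \<le> 1/20"
    using mu_le kap k1 by (simp add: x_def field_simps)
  then have d20: "\<delta> ^ 3 \<le> 1/20" by (simp add: d3)
  have "\<epsilon> = \<mu> * \<kappa> * f k" using kap by (simp add: \<epsilon>_def f_def)
  also have "\<dots> \<le> x * f k"
    using mult_left_mono[OF k1, of "\<mu> * \<kappa>"] mu kap fk
    by (intro mult_right_mono) (auto simp: x_def mult_ac)
  finally have t: "\<epsilon> \<le> \<delta> ^ 3 * f k" by (simp add: d3)
  \<comment> \<open>Multiplying the first bound on \<mu> by the square of \<mu> makes the right-hand
    side a perfect cube in \<delta> and \<Delta>; taking cube roots then gives a bound that the gap
    assumption turns into \<open>s\<close>.\<close>
  have "\<mu> ^ 3 = \<mu>\<^sup>2 * \<mu>" by (simp add: power3_eq_cube power2_eq_square)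
  also have "\<dots> \<le> \<mu>\<^sup>2 * (\<Delta> ^ 3 * (real k * \<kappa>)\<^sup>2)"
    using mu_le by (intro mult_left_mono) auto
  also have "\<dots> = \<Delta> ^ 3 * (\<delta> ^ 3)\<^sup>2"
    unfolding d3 x_def by (simp add: power_mult_distrib mult_ac)
  also have "\<dots> = (\<delta>\<^sup>2 * \<Delta>) ^ 3"
    by (simp add: power_mult_distrib mult_ac flip: power_mult)
  finally have "\<mu> \<le> \<delta>\<^sup>2 * \<Delta>"
    using Delta_pos by (subst (asm) power_mono_iff) (auto simp: mu)
  then have "\<epsilon> \<le> \<delta>\<^sup>2 * \<Delta> * f 1"
    unfolding \<epsilon>_def f_def by (rule mult_right_mono) simp
  also have "\<dots> \<le> \<delta>\<^sup>2 * (f k - f (Suc k))"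
    unfolding mult.assoc by (rule mult_left_mono) (use gap in \<open>auto simp: f_def\<close>)
  finally have s: "\<epsilon> \<le> \<delta>\<^sup>2 * (f k - f (Suc k))" .
  have gam: "0 < f k - f (Suc k)"
    using gap mult_pos_pos[OF Delta_pos f1] by (simp add: f_def)
  note num = perturbation_bound_numeric[OF fk \<open>0 \<le> \<epsilon>\<close> gam d0 t s d20]
  \<comment> \<open>The first \<open>k\<close> singular values are positive, so the square of
    \<open>Sk\<close> is inverted entrywise on the diagonal.\<close>
  have inv: "matrix_inv (Sk ** Sk) = rect_diag (\<lambda>i. 1 / f i)"
  proof (rule matrix_inv_unique)
    have "f (position i) \<noteq> 0" for i :: 'k
      using fpos[of "position i"] position_ge_1[of i] position_le[of i] by (simp add: k_def)
    then show "Sk ** Sk ** rect_diag (\<lambda>i. 1 / f i) = mat 1"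
      unfolding Sk_def rect_diag_mult
      by (auto simp: rect_diag_def mat_def vec_eq_iff f_def power2_eq_square)
  qed
  have cols: "first_columns Z ** matrix_inv (Sk ** Sk)
        ** transpose (first_columns Z :: real ^ 'k::{finite,linorder} ^ 'n::{finite,linorder})
      = spectral Z (\<lambda>i. if i \<le> k then 1 / f i else 0)"
    for Z :: "real ^ 'n::{finite,linorder} ^ 'n::{finite,linorder}"
    using spectral_first_columns[of Z "\<lambda>i. 1 / f i", where 'k='k] k_less d_le
    by (simp add: inv k_def flip: spectral_def)
  have "opnorm (spectral U (\<lambda>i. if i \<le> k then 1 / f i else 0)
               - spectral Ut (\<lambda>i. if i \<le> k then 1 / f i else 0)) \<le> 8 / f k * \<delta>"
    by (rule order.trans[OF truncated_inverse_perturbation[OF U W _ _ _ _ eps] num(2)])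
      (use fmono gmono k_ge k_less d_le num(1) in \<open>auto simp: f_def g_def\<close>)
  then show ?thesis
    unfolding Uk_def Utk_def cols by (simp add: \<delta>_def x_def f_def)
qed

end
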